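(* (Soundness) For every formula $\varphi$, if $\vdash\varphi$ (derivable in $\mathsf{Syn}$) then $\Vdash_\sigma\varphi$ ($\varphi$ is true at every simplex of every simplicial model).
   Context: Fix a finite set $\mathsf{Ag}$ of agents and let $\mathsf{Ag}_{si}=\{(A,i)\mid A\subseteq \mathsf{Ag},\ i\in\mathbb{N}\}$. For $S\subseteq \mathsf{Ag}_{si}$, $(A,i)\in S$ is maximal in $S$ if $|A|\ge |B|$ for all $(B,j)\in S$. A nonempty $S\subseteq\mathsf{Ag}_{si}$ is a simplex if (S1) it has a unique maximal element $\max(S)$; (S2) for every $(B,i)\in S$ and $C\subseteq B$ there is exactly one $j$ with $(C,j)\in S$; (S3) if $(B,i)\in S$ and $(A,j)=\max(S)$ then $B\subseteq A$. A set $\mathbb{C}$ of simplices is a complex if for all $S,T\in\mathbb{C}$: if $(A,i)\in S\cap T$ then for all $B\subseteq A$ and all $j$, $(B,j)\in S$ iff $(B,j)\in T$. $S^\circ=\{A\mid\exists i\,(A,i)\in S\}$. An agent pattern is a set $G\subseteq \mathcal{P}(\mathsf{Ag})\setminus\{\emptyset\}$; $S\sim_G T$ iff $G\subseteq(S\cap T)^\circ$. Formulas: $\varphi::= p\mid\neg\varphi\mid\varphi\wedge\varphi\mid [G]\varphi$ ($p$ in a countable set $\mathsf{Prop}$, $G$ an agent pattern); $\bot:=p\wedge\neg p$ for fixed $p$; $\mathsf{alive}(G):=\neg[G]\bot$; $G^C:=\{H\in\mathcal{P}(\mathsf{Ag})\setminus\{\emptyset\}\mid \neg\exists B\in G.\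 H\subseteq B\}$; $\mathsf{dead}(G):=\bigwedge_{B\in G}\neg\mathsf{alive}(\{B\})$. $\mathsf{Syn}$: all propositional tautologies; (K) $[G](\varphi\to\psi)\to([G]\varphi\to[G]\psi)$; (B) $\varphi\to[G]\neg[G]\neg\varphi$; (4) $[G]\varphi\to[G][G]\varphi$; (T) $\mathsf{alive}(G)\to([G]\varphi\to\varphi)$; (P) $\mathsf{alive}(G)\wedge\mathsf{dead}(G^C)\wedge\varphi\to[G](\mathsf{dead}(G^C)\to\varphi)$; (NE) $\bigvee_{G}\mathsf{alive}(G)$ over all agent patterns; (Mono) $[G]\varphi\to[H]\varphi$ if $G\subseteq H$; (Equiv) $[G\cup\{B\}]\varphi\to[G]\varphi$ if some $A\in G$ has $B\subseteq A$ ($B\ne\emptyset$); (Union) $\mathsf{alive}(G)\wedge\mathsf{alive}(H)\to\mathsf{alive}(G\cup H)$; (Clo) $\mathsf{alive}(G)\to\mathsf{alive}(\{A\cup B\})$ for $A,B\in G$; rules modus ponens and $[G]$-necessitation. A simplicial model is $(\mathbb{C},L)$ with $\mathbb{C}$ a complex and $L:\mathbb{C}\to\mathcal{P}(\mathsf{Prop})$; $\mathcal{C},S\Vdash_\sigma p$ iff $p\in L(S)$; Boolean clauses as usual; $\mathcal{C},S\Vdash_\sigma[G]\varphi$ iff $\mathcal{C},T\Vdash_\sigma\varphi$ for all $T\in\mathbb{C}$ with $S\sim_G T$.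
   Formalization: Soundness is proved for models whose complex contains at most one simplex of the form {(∅,i)}; without this, axiom (P) with G=∅ fails on the complex {{(∅,0)},{(∅,1)}} when p holds at only one of the two simplices. *)

theory Defs
  imports "HOL-Library.Countable"
begin

type_synonym 'a simp = "('a set \<times> nat) set"

definition Ag_si :: "'a set \<Rightarrow> ('a set \<times> nat) set" where
  "Ag_si Ag = {(A, i). A \<subseteq> Ag}"

definition maximal_in :: "'a simp \<Rightarrow> 'a set \<times> nat \<Rightarrow> bool" where
  "maximal_in S x \<longleftrightarrow> x \<in> S \<and> (\<forall>(B, j) \<in> S. card (fst x) \<ge> card B)"

text \<open>Only meaningful when the maximal element is unique.\<close>

definition max_elt :: "'a simp \<Rightarrow> 'a set \<times> nat" where
  "max_elt S = (THE x. maximal_in S x)"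

definition simplex :: "'a set \<Rightarrow> 'a simp \<Rightarrow> bool" where
  "simplex Ag S \<longleftrightarrow> S \<noteq> {} \<and> S \<subseteq> Ag_si Ag \<and>
     (\<exists>!x. maximal_in S x) \<and>
     (\<forall>(B, i) \<in> S. \<forall>C. C \<subseteq> B \<longrightarrow> (\<exists>!j. (C, j) \<in> S)) \<and>
     (\<forall>(B, i) \<in> S. B \<subseteq> fst (max_elt S))"

definition complex :: "'a set \<Rightarrow> 'a simp set \<Rightarrow> bool" where
  "complex Ag \<C> \<longleftrightarrow> (\<forall>S \<in> \<C>. simplex Ag S) \<and>
     (\<forall>S \<in> \<C>. \<forall>T \<in> \<C>. \<forall>(A, i) \<in> S \<inter> T.
        \<forall>B j. B \<subseteq> A \<longrightarrow> ((B, j) \<in> S \<longleftrightarrow> (B, j) \<in> T))"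

definition circ :: "'a simp \<Rightarrow> 'a set set" where
  "circ S = {A. \<exists>i. (A, i) \<in> S}"

definition agent_patterns :: "'a set \<Rightarrow> 'a set set set" where
  "agent_patterns Ag = {G. G \<subseteq> Pow Ag - {{}}}"

definition indist :: "'a set set \<Rightarrow> 'a simp \<Rightarrow> 'a simp \<Rightarrow> bool" where
  "indist G S T \<longleftrightarrow> G \<subseteq> circ (S \<inter> T)"

datatype ('a, 'p) fm =
    Atom 'p
  | Neg "('a, 'p) fm"
  | Conj "('a, 'p) fm" "('a, 'p) fm"
  | Box "'a set set" "('a, 'p) fm"

text \<open>The datatype admits arbitrary families of sets as modalities; the formulas over
  \<open>Ag\<close> are those whose modalities are agent patterns.\<close>

primrec is_formula :: "'a set \<Rightarrow> ('a, 'p) fm \<Rightarrow> bool" where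
  "is_formula Ag (Atom p) = True"
| "is_formula Ag (Neg \<phi>) = is_formula Ag \<phi>"
| "is_formula Ag (Conj \<phi> \<psi>) = (is_formula Ag \<phi> \<and> is_formula Ag \<psi>)"
| "is_formula Ag (Box G \<phi>) = (G \<in> agent_patterns Ag \<and> is_formula Ag \<phi>)"

definition Imp :: "('a, 'p) fm \<Rightarrow> ('a, 'p) fm \<Rightarrow> ('a, 'p) fm" where
  "Imp \<phi> \<psi> = Neg (Conj \<phi> (Neg \<psi>))"

definition Disj :: "('a, 'p) fm \<Rightarrow> ('a, 'p) fm \<Rightarrow> ('a, 'p) fm" where
  "Disj \<phi> \<psi> = Neg (Conj (Neg \<phi>) (Neg \<psi>))"

definition fixed_prop :: 'p where
  "fixed_prop = (SOME p. True)"

definition Bot :: "('a, 'p) fm" where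
  "Bot = Conj (Atom fixed_prop) (Neg (Atom fixed_prop))"

text \<open>Conjunctions and disjunctions over a finite index set are taken along an arbitrary
  fixed enumeration, and end in their neutral element.\<close>

definition enum_set :: "'b set \<Rightarrow> 'b list" where
  "enum_set X = (SOME xs. set xs = X \<and> distinct xs)"

definition big_conj :: "'b set \<Rightarrow> ('b \<Rightarrow> ('a, 'p) fm) \<Rightarrow> ('a, 'p) fm" where
  "big_conj X f = foldr (\<lambda>x. Conj (f x)) (enum_set X) (Neg Bot)"

definition big_disj :: "'b set \<Rightarrow> ('b \<Rightarrow> ('a, 'p) fm) \<Rightarrow> ('a, 'p) fm" where
  "big_disj X f = foldr (\<lambda>x. Disj (f x)) (enum_set X) Bot"

definition alive :: "'a set set \<Rightarrow> ('a, 'p) fm" where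
  "alive G = Neg (Box G Bot)"

definition pattern_compl :: "'a set \<Rightarrow> 'a set set \<Rightarrow> 'a set set" where
  "pattern_compl Ag G = {H \<in> Pow Ag - {{}}. \<not> (\<exists>B \<in> G. H \<subseteq> B)}"

definition dead :: "'a set set \<Rightarrow> ('a, 'p) fm" where
  "dead G = big_conj G (\<lambda>B. Neg (alive {B}))"

text \<open>Propositional tautologies are the formulas true under every valuation that treats
  propositions and boxed formulas alike as atoms.\<close>

primrec prop_eval :: "(('a, 'p) fm \<Rightarrow> bool) \<Rightarrow> ('a, 'p) fm \<Rightarrow> bool" where
  "prop_eval v (Atom p) = v (Atom p)"
| "prop_eval v (Neg \<phi>) = (\<not> prop_eval v \<phi>)"
| "prop_eval v (Conj \<phi> \<psi>) = (prop_eval v \<phi> \<and> prop_eval v \<psi>)"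
| "prop_eval v (Box G \<phi>) = v (Box G \<phi>)"

definition tautology :: "('a, 'p) fm \<Rightarrow> bool" where
  "tautology \<phi> \<longleftrightarrow> (\<forall>v. prop_eval v \<phi>)"

inductive Syn :: "'a set \<Rightarrow> ('a, 'p) fm \<Rightarrow> bool" for Ag :: "'a set" where
  Taut: "\<lbrakk>is_formula Ag \<phi>; tautology \<phi>\<rbrakk> \<Longrightarrow> Syn Ag \<phi>"
| K: "\<lbrakk>G \<in> agent_patterns Ag; is_formula Ag \<phi>; is_formula Ag \<psi>\<rbrakk>
    \<Longrightarrow> Syn Ag (Imp (Box G (Imp \<phi> \<psi>)) (Imp (Box G \<phi>) (Box G \<psi>)))"
| B: "\<lbrakk>G \<in> agent_patterns Ag; is_formula Ag \<phi>\<rbrakk>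
    \<Longrightarrow> Syn Ag (Imp \<phi> (Box G (Neg (Box G (Neg \<phi>)))))"
| Four: "\<lbrakk>G \<in> agent_patterns Ag; is_formula Ag \<phi>\<rbrakk>
    \<Longrightarrow> Syn Ag (Imp (Box G \<phi>) (Box G (Box G \<phi>)))"
| T: "\<lbrakk>G \<in> agent_patterns Ag; is_formula Ag \<phi>\<rbrakk>
    \<Longrightarrow> Syn Ag (Imp (alive G) (Imp (Box G \<phi>) \<phi>))"
| P: "\<lbrakk>G \<in> agent_patterns Ag; is_formula Ag \<phi>\<rbrakk>
    \<Longrightarrow> Syn Ag (Imp (Conj (Conj (alive G) (dead (pattern_compl Ag G))) \<phi>)
                 (Box G (Imp (dead (pattern_compl Ag G)) \<phi>)))"
| NE: "Syn Ag (big_disj (agent_patterns Ag) alive)"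
| Mono: "\<lbrakk>G \<in> agent_patterns Ag; H \<in> agent_patterns Ag; G \<subseteq> H; is_formula Ag \<phi>\<rbrakk>
    \<Longrightarrow> Syn Ag (Imp (Box G \<phi>) (Box H \<phi>))"
| Equiv: "\<lbrakk>G \<in> agent_patterns Ag; A \<in> G; B \<subseteq> A; B \<noteq> {}; is_formula Ag \<phi>\<rbrakk>
    \<Longrightarrow> Syn Ag (Imp (Box (G \<union> {B}) \<phi>) (Box G \<phi>))"
| Union: "\<lbrakk>G \<in> agent_patterns Ag; H \<in> agent_patterns Ag\<rbrakk>
    \<Longrightarrow> Syn Ag (Imp (Conj (alive G) (alive H)) (alive (G \<union> H)))"
| Clo: "\<lbrakk>G \<in> agent_patterns Ag; A \<in> G; B \<in> G\<rbrakk>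
    \<Longrightarrow> Syn Ag (Imp (alive G) (alive {A \<union> B}))"
| MP: "\<lbrakk>Syn Ag (Imp \<phi> \<psi>); Syn Ag \<phi>\<rbrakk> \<Longrightarrow> Syn Ag \<psi>"
| Nec: "\<lbrakk>G \<in> agent_patterns Ag; Syn Ag \<phi>\<rbrakk> \<Longrightarrow> Syn Ag (Box G \<phi>)"

text \<open>A simplicial model is a pair of a complex \<open>\<C>\<close> and a labelling \<open>L\<close>, of which only the
  values on \<open>\<C>\<close> matter.\<close>

primrec sat :: "'a simp set \<Rightarrow> ('a simp \<Rightarrow> 'p set) \<Rightarrow> 'a simp \<Rightarrow> ('a, 'p) fm \<Rightarrow> bool" where
  "sat \<C> L S (Atom p) = (p \<in> L S)"
| "sat \<C> L S (Neg \<phi>) = (\<not> sat \<C> L S \<phi>)"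
| "sat \<C> L S (Conj \<phi> \<psi>) = (sat \<C> L S \<phi> \<and> sat \<C> L S \<psi>)"
| "sat \<C> L S (Box G \<phi>) = (\<forall>T \<in> \<C>. indist G S T \<longrightarrow> sat \<C> L T \<phi>)"

text \<open>The singletons \<open>{({}, i)}\<close> satisfy the definition of a simplex, and two of them may lie
  in one complex.  They are then distinct, related by the empty agent pattern, and have every
  nonempty set of agents dead, so axiom P for the empty pattern fails.  The next predicate
  excludes exactly this; the lemmas after it show that it cannot be dropped from soundness.\<close>

definition agentless_unique :: "'a simp set \<Rightarrow> bool" where
  "agentless_unique \<C> \<longleftrightarrow> (\<forall>i j. {({}, i)} \<in> \<C> \<longrightarrow> {({}, j)} \<in> \<C> \<longrightarrow> i = j)"

lemma set_enum_set: "finite X \<Longrightarrow> set (enum_set X) = X"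
  unfolding enum_set_def by (rule someI2_ex) (auto dest: finite_distinct_list)

lemma sat_big_conj:
  assumes "finite X"
  shows "sat \<C> L S (big_conj X f) \<longleftrightarrow> (\<forall>x \<in> X. sat \<C> L S (f x))"
proof -
  have "sat \<C> L S (foldr (\<lambda>x. Conj (f x)) xs (Neg Bot)) \<longleftrightarrow> (\<forall>x \<in> set xs. sat \<C> L S (f x))" for xs
    by (induction xs) (auto simp: Bot_def)
  then show ?thesis
    by (simp add: big_conj_def set_enum_set[OF assms])
qed

lemma complex_two_agentless: "complex Ag {{({}, 0)}, {({}, 1)}}"
proof -
  have max: "maximal_in {({}, i)} x \<longleftrightarrow> x = ({}, i)" for i and x :: "'a set \<times> nat"
    by (auto simp: maximal_in_def)
  show ?thesis
    by (auto simp: complex_def simplex_def Ag_si_def max_elt_def max)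
qed

lemma agentless_unique_necessary:
  fixes Ag :: "'a set" and \<C> :: "'a simp set"
  assumes fin: "finite Ag" and nu: "\<not> agentless_unique \<C>"
  shows "\<exists>(\<phi> :: ('a, 'p) fm) L. \<exists>S \<in> \<C>. is_formula Ag \<phi> \<and> Syn Ag \<phi> \<and> \<not> sat \<C> L S \<phi>"
proof -
  obtain i j where ij: "{({}, i)} \<in> \<C>" "{({}, j)} \<in> \<C>" "i \<noteq> j"
    using nu by (auto simp: agentless_unique_def)
  define p where "p = (Atom fixed_prop :: ('a, 'p) fm)"
  define D where "D = (dead (pattern_compl Ag {}) :: ('a, 'p) fm)"
  define \<phi> where "\<phi> = Imp (Conj (Conj (alive {}) D) p) (Box {} (Imp D p))"
  define L :: "'a simp \<Rightarrow> 'p set" where "L = (\<lambda>S. if S = {({}, i)} then UNIV else {})"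
  have finc: "finite (pattern_compl Ag {})"
    using fin by (simp add: pattern_compl_def)
  have "Syn Ag \<phi>"
    unfolding \<phi>_def D_def by (rule P) (auto simp: agent_patterns_def p_def)
  moreover have "is_formula Ag D"
  proof -
    have "is_formula Ag (foldr (\<lambda>B. Conj (Neg (alive {B}))) xs (Neg Bot) :: ('a, 'p) fm)"
      if "set xs \<subseteq> Pow Ag - {{}}" for xs
      using that by (induction xs) (auto simp: Bot_def alive_def agent_patterns_def)
    moreover have "set (enum_set (pattern_compl Ag {})) \<subseteq> Pow Ag - {{}}"
      unfolding set_enum_set[OF finc] by (auto simp: pattern_compl_def)
    ultimately show ?thesis
      unfolding D_def dead_def big_conj_def by blast
  qed
  then have "is_formula Ag \<phi>"
    by (auto simp: \<phi>_def Imp_def p_def alive_def Bot_def agent_patterns_def)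
  moreover have "sat \<C> L {({}, k)} D" for k
    unfolding D_def dead_def sat_big_conj[OF finc]
    by (auto simp: alive_def Bot_def indist_def circ_def pattern_compl_def)
  then have "\<not> sat \<C> L {({}, i)} \<phi>"
    using ij by (auto simp: \<phi>_def Imp_def p_def L_def alive_def Bot_def indist_def
        intro!: bexI[of _ "{({}, j)}"])
  ultimately show ?thesis
    using ij(1) by blast
qed

end

theory Submission
  imports Defs
begin

text \<open>A pattern is alive at a simplex iff all its members occur in it, so on a complex each
  relation \<open>indist G\<close> is a partial equivalence relation, reflexive exactly where \<open>G\<close> is alive.
  The only axiom that needs more is P: if every nonempty face of \<open>S\<close> and of \<open>T\<close> lies below a
  member of \<open>G\<close>, and \<open>S\<close> and \<open>T\<close> share the faces in \<open>G\<close>, then the complex condition gives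
  \<open>S = T\<close>.  For empty \<open>G\<close> this leaves two agentless simplices, which are assumed to coincide.\<close>

section \<open>Face structure of simplices and complexes\<close>

lemma circ_iff: "A \<in> circ S \<longleftrightarrow> (\<exists>i. (A, i) \<in> S)"
  by (simp add: circ_def)

lemma simplex_subset_unique:
  assumes S: "simplex Ag S" and B: "(B, i) \<in> S" and C: "C \<subseteq> B"
  shows "\<exists>!j. (C, j) \<in> S"
proof -
  have "\<forall>(B, i) \<in> S. \<forall>C. C \<subseteq> B \<longrightarrow> (\<exists>!j. (C, j) \<in> S)"
    using S by (simp add: simplex_def)
  from bspec[OF this B] show ?thesis
    using C by simp
qed

lemma simplex_circ_subset:
  assumes S: "simplex Ag S" and B: "B \<in> circ S" and C: "C \<subseteq> B"
  shows "C \<in> circ S"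
proof -
  obtain i where "(B, i) \<in> S"
    using B circ_iff by blast
  from simplex_subset_unique[OF S this C] show ?thesis
    unfolding circ_iff by (rule ex1_implies_ex)
qed

lemma simplex_index_unique:
  assumes S: "simplex Ag S" and i: "(B, i) \<in> S" and j: "(B, j) \<in> S"
  shows "i = j"
  using simplex_subset_unique[OF S i order_refl] i j by blast

lemma simplex_nonempty: "simplex Ag S \<Longrightarrow> S \<noteq> {}"
  by (simp add: simplex_def)

lemma simplex_circ_agents:
  assumes "simplex Ag S" "A \<in> circ S"
  shows "A \<subseteq> Ag"
proof -
  have "S \<subseteq> Ag_si Ag"
    using assms(1) by (simp add: simplex_def)
  then show ?thesis
    using assms(2) by (auto simp: Ag_si_def circ_iff)
qed

lemma simplex_circ_max:
  assumes "simplex Ag S" "A \<in> circ S"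
  shows "A \<subseteq> fst (max_elt S)"
proof -
  have "\<forall>(B, i) \<in> S. B \<subseteq> fst (max_elt S)"
    using assms(1) by (simp add: simplex_def)
  then show ?thesis
    using assms(2) by (auto simp: circ_iff)
qed

text \<open>By (S3) the maximal face contains \<open>A\<close> and \<open>B\<close>, hence their
  union, and (S2) makes faces downward closed. Axiom Clo rests on this.\<close>

lemma simplex_circ_Un:
  assumes S: "simplex Ag S" and A: "A \<in> circ S" and B: "B \<in> circ S"
  shows "A \<union> B \<in> circ S"
proof -
  have "\<exists>!x. maximal_in S x"
    using S by (simp add: simplex_def)
  then have "maximal_in S (max_elt S)"
    unfolding max_elt_def by (rule theI')
  then have "max_elt S \<in> S"
    by (simp add: maximal_in_def)
  then have "fst (max_elt S) \<in> circ S"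
    unfolding circ_iff by (metis prod.collapse)
  moreover have "A \<union> B \<subseteq> fst (max_elt S)"
    using simplex_circ_max[OF S] A B by simp
  ultimately show ?thesis
    using simplex_circ_subset[OF S] by blast
qed

lemma complex_simplex: "complex Ag \<C> \<Longrightarrow> S \<in> \<C> \<Longrightarrow> simplex Ag S"
  by (simp add: complex_def)

lemma complex_face:
  assumes "complex Ag \<C>" "S \<in> \<C>" "T \<in> \<C>" "A \<in> circ (S \<inter> T)" "B \<subseteq> A"
  shows "(B, j) \<in> S \<longleftrightarrow> (B, j) \<in> T"
proof -
  obtain i where A: "(A, i) \<in> S \<inter> T"
    using assms(4) circ_iff by blast
  have "\<forall>(A, i) \<in> S \<inter> T. \<forall>B j. B \<subseteq> A \<longrightarrow> ((B, j) \<in> S \<longleftrightarrow> (B, j) \<in> T)"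
    using assms(1-3) by (simp add: complex_def)
  from bspec[OF this A] show ?thesis
    using assms(5) by simp
qed

section \<open>Indistinguishability as a partial equivalence\<close>

lemma indist_sym: "indist G S T \<longleftrightarrow> indist G T S"
  by (simp add: indist_def Int_commute)

lemma indist_refl_iff: "indist G S S \<longleftrightarrow> G \<subseteq> circ S"
  by (simp add: indist_def)

lemma indist_imp_circ: "indist G S T \<Longrightarrow> G \<subseteq> circ S"
  by (auto simp: indist_def circ_def)

text \<open>By (S2) each face of \<open>T\<close> has a single index, so the copy of a face that
  \<open>T\<close> shares with \<open>S\<close> is the one it shares with \<open>U\<close>.\<close>

lemma indist_trans:
  assumes T: "simplex Ag T" and ST: "indist G S T" and TU: "indist G T U"
  shows "indist G S U"
  unfolding indist_def
proof
  fix A assume "A \<in> G"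
  then obtain i j where "(A, i) \<in> S" "(A, i) \<in> T" "(A, j) \<in> T" "(A, j) \<in> U"
    using ST TU unfolding indist_def circ_def by blast
  moreover from this have "i = j"
    using simplex_index_unique[OF T] by blast
  ultimately show "A \<in> circ (S \<inter> U)"
    by (auto simp: circ_def)
qed

section \<open>Semantics of the derived connectives\<close>

lemma sat_Bot [simp]: "\<not> sat \<C> L S Bot"
  by (simp add: Bot_def)

lemma sat_Imp [simp]: "sat \<C> L S (Imp \<phi> \<psi>) \<longleftrightarrow> (sat \<C> L S \<phi> \<longrightarrow> sat \<C> L S \<psi>)"
  by (simp add: Imp_def)

text \<open>Any simplex refuting \<open>Box G Bot\<close> shares the faces in \<open>G\<close> with
  \<open>S\<close>; conversely \<open>S\<close> itself is such a simplex, being in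
  \<open>\<C>\<close>.\<close>

lemma sat_alive:
  assumes "S \<in> \<C>"
  shows "sat \<C> L S (alive G) \<longleftrightarrow> G \<subseteq> circ S"
proof
  assume "sat \<C> L S (alive G)"
  then show "G \<subseteq> circ S"
    using indist_imp_circ by (auto simp: alive_def)
next
  assume "G \<subseteq> circ S"
  then show "sat \<C> L S (alive G)"
    using assms indist_refl_iff by (auto simp: alive_def)
qed

lemma sat_big_disj:
  assumes "finite X"
  shows "sat \<C> L S (big_disj X f) \<longleftrightarrow> (\<exists>x \<in> X. sat \<C> L S (f x))"
proof -
  \<comment> \<open>The enumeration is an unspecified choice, so the induction covers all
    lists.\<close>
  have "sat \<C> L S (foldr (\<lambda>x. Disj (f x)) xs Bot) \<longleftrightarrow> (\<exists>x \<in> set xs. sat \<C> L S (f x))" for xs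
    by (induction xs) (auto simp: Disj_def)
  then show ?thesis
    by (simp add: big_disj_def set_enum_set[OF assms])
qed

lemma sat_dead:
  assumes "finite G" "S \<in> \<C>"
  shows "sat \<C> L S (dead G) \<longleftrightarrow> G \<inter> circ S = {}"
  using assms by (auto simp: dead_def sat_big_conj sat_alive)

text \<open>Truth at \<open>S\<close> is itself a valuation with boxed formulas as atoms, so
  tautologies hold at \<open>S\<close>.\<close>

lemma sat_prop_eval: "prop_eval (sat \<C> L S) \<phi> \<longleftrightarrow> sat \<C> L S \<phi>"
  by (induction \<phi>) auto

section \<open>Rigidity under a dead complement, for axiom P\<close>

lemma simplex_agentless:
  assumes S: "simplex Ag S" and dead: "pattern_compl Ag {} \<inter> circ S = {}"
  obtains i where "S = {({}, i)}"
proof -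
  \<comment> \<open>The complement of the empty pattern contains every nonempty set of agents, so
    only the empty face can occur.\<close>
  have empty: "A = {}" if "(A, i) \<in> S" for A i
  proof -
    have "A \<subseteq> Ag"
      using simplex_circ_agents[OF S] that circ_iff by blast
    moreover have "A \<notin> pattern_compl Ag {}"
      using that dead circ_iff by blast
    ultimately show ?thesis
      by (simp add: pattern_compl_def)
  qed
  obtain A i where "(A, i) \<in> S"
    using simplex_nonempty[OF S] by auto
  then have i: "({}, i) \<in> S"
    using empty by blast
  then have "S = {({}, i)}"
    using simplex_index_unique[OF S] empty by fast
  then show thesis
    by (rule that)
qed

lemma indist_dead_compl_subset:
  assumes C: "complex Ag \<C>" and S: "S \<in> \<C>" and T: "T \<in> \<C>"
    and ST: "indist G S T" and dead: "pattern_compl Ag G \<inter> circ S = {}" and G: "G \<noteq> {}"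
  shows "S \<subseteq> T"
proof (rule subrelI)
  fix H i assume H: "(H, i) \<in> S"
  have "H \<subseteq> Ag"
    using simplex_circ_agents[OF complex_simplex[OF C S]] H circ_iff by blast
  moreover have "H \<notin> pattern_compl Ag G"
    using H dead circ_iff by blast
  \<comment> \<open>An empty \<open>H\<close> is never in the complement; for it, \<open>B\<close>
    comes from \<open>G\<close> being nonempty.\<close>
  ultimately obtain B where B: "B \<in> G" "H \<subseteq> B"
    using G unfolding pattern_compl_def by blast
  then have "B \<in> circ (S \<inter> T)"
    using ST by (auto simp: indist_def)
  then show "(H, i) \<in> T"
    using complex_face[OF C S T _ B(2)] H by simp
qed

lemma indist_dead_compl_eq:
  assumes C: "complex Ag \<C>" and u: "agentless_unique \<C>" and S: "S \<in> \<C>" and T: "T \<in> \<C>"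
    and ST: "indist G S T" and deadS: "pattern_compl Ag G \<inter> circ S = {}"
    and deadT: "pattern_compl Ag G \<inter> circ T = {}"
  shows "S = T"
proof (cases "G = {}")
  case True
  obtain i where i: "S = {({}, i)}"
    by (rule simplex_agentless[OF complex_simplex[OF C S] deadS[unfolded True]])
  obtain j where j: "T = {({}, j)}"
    by (rule simplex_agentless[OF complex_simplex[OF C T] deadT[unfolded True]])
  show ?thesis
    using u S T i j by (simp add: agentless_unique_def)
next
  case False
  \<comment> \<open>The inclusion uses deadness only at its left simplex, so it is applied once in
    each direction.\<close>
  have TS: "indist G T S"
    using ST by (subst indist_sym)
  show ?thesis
    using indist_dead_compl_subset[OF C S T ST deadS False]
      indist_dead_compl_subset[OF C T S TS deadT False]
    by (rule subset_antisym)
qed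

text \<open>For axiom Equiv: (S2) gives \<open>B\<close> an index in \<open>S\<close>, and the
  complex condition below the shared face \<open>A\<close> carries that indexed face over to
  \<open>T\<close>.\<close>

lemma indist_insert_subset:
  assumes C: "complex Ag \<C>" and S: "S \<in> \<C>" and T: "T \<in> \<C>"
    and ST: "indist G S T" and A: "A \<in> G" and B: "B \<subseteq> A"
  shows "indist (G \<union> {B}) S T"
proof -
  have AST: "A \<in> circ (S \<inter> T)"
    using ST A by (auto simp: indist_def)
  then have "A \<in> circ S"
    by (auto simp: circ_iff)
  then have "B \<in> circ S"
    using simplex_circ_subset[OF complex_simplex[OF C S]] B by blast
  then have "B \<in> circ (S \<inter> T)"
    using complex_face[OF C S T AST B] unfolding circ_iff by blast
  then show ?thesis
    using ST by (simp add: indist_def)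
qed

text \<open>Induction on the derivation; \<open>S\<close> stays arbitrary because necessitation
  needs truth at every simplex of \<open>\<C>\<close>.\<close>

lemma Syn_sound:
  assumes fin: "finite Ag" and C: "complex Ag \<C>" and u: "agentless_unique \<C>"
    and "Syn Ag \<phi>" and "S \<in> \<C>"
  shows "sat \<C> L S \<phi>"
  using assms(4,5)
proof (induction arbitrary: S rule: Syn.induct)
  case (Taut \<phi>)
  then show ?case
    by (simp add: tautology_def flip: sat_prop_eval)
next
  case (B G \<phi>)
  then show ?case
    by simp (metis indist_sym)
next
  case (Four G \<phi>)
  then show ?case
    by simp (metis indist_trans complex_simplex[OF C])
next
  \<comment> \<open>Where \<open>G\<close> is alive, \<open>S\<close> is among its own
    \<open>G\<close>-successors.\<close>
  case (T G \<phi>)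
  then show ?case
    by (simp add: sat_alive indist_refl_iff)
next
  case (P G \<phi>)
  have compl: "finite (pattern_compl Ag G)"
    using fin by (simp add: pattern_compl_def)
  have "sat \<C> L T \<phi>"
    if "pattern_compl Ag G \<inter> circ S = {}" "sat \<C> L S \<phi>" "T \<in> \<C>" "indist G S T"
      "pattern_compl Ag G \<inter> circ T = {}" for T
    using indist_dead_compl_eq[OF C u P.prems that(3,4,1,5)] that(2) by simp
  then show ?case
    using P.prems by (simp add: sat_dead[OF compl])
next
  case NE
  \<comment> \<open>The patterns form the power set of \<open>Pow Ag - {{}}\<close>.\<close>
  have "finite (agent_patterns Ag)"
    using fin by (simp add: agent_patterns_def flip: Pow_def)
  \<comment> \<open>The empty pattern is alive at every simplex and witnesses the
    disjunction.\<close>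
  moreover have "sat \<C> L S (alive {})" "{} \<in> agent_patterns Ag"
    using NE by (simp_all add: sat_alive agent_patterns_def)
  ultimately show ?case
    by (auto simp: sat_big_disj)
next
  \<comment> \<open>A larger pattern relates fewer simplices.\<close>
  case (Mono G H \<phi>)
  then show ?case
    by (auto simp: indist_def)
next
  case (Equiv G A B \<phi>)
  then show ?case
    using indist_insert_subset[OF C] by simp
next
  case (Union G H)
  then show ?case
    by (simp add: sat_alive)
next
  case (Clo G A B)
  then show ?case
    using simplex_circ_Un[OF complex_simplex[OF C Clo.prems]] by (simp add: sat_alive subset_iff)
next
  case (K G \<phi> \<psi>)
  then show ?case
    by simp
next
  case (MP \<phi> \<psi>)
  then show ?case
    by simp
next
  case (Nec G \<phi>)
  then show ?case
    by simp
qed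

theorem theorem3p4:
  fixes Ag :: "'a set" and \<phi> :: "('a, 'p::countable) fm"
  assumes "finite Ag" and "is_formula Ag \<phi>" and "Syn Ag \<phi>"
  shows "\<forall>\<C> L. complex Ag \<C> \<and> agentless_unique \<C> \<longrightarrow> (\<forall>S \<in> \<C>. sat \<C> L S \<phi>)"
  using Syn_sound assms(1,3) by blast

end
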